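(* A ring $R$ is a uniquely clean ring if and only if it is a uniquely $\sqrt{J}$-clean ring.
   Context: Rings are associative with identity $1\neq 0$ (not necessarily commutative). $J(R)$ is the Jacobson radical of $R$, and $\sqrt{J(R)}=\{z\in R : z^n\in J(R)\text{ for some } n\ge 1\}$. A ring $R$ is uniquely clean if every $a\in R$ can be written in exactly one way as $a=e+u$ with $e$ an idempotent and $u$ a unit of $R$. A ring $R$ is uniquely $\sqrt{J}$-clean if every $a\in R$ can be written in exactly one way as $a=e+z$ with $e$ an idempotent of $R$ and $z\in\sqrt{J(R)}$. *)

theory Defs
  imports Main
begin

text \<open>
  The rings of the statement are the types of class \<open>ring_1\<close>: associative, with \<open>0 \<noteq> 1\<close>, and not
  necessarily commutative. For this reason invertibility is two-sided here; the library's
  \<open>u dvd 1\<close> only asserts a right inverse. Properties of a ring as a whole are predicates on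
  \<open>TYPE('a)\<close>.
\<close>

definition idempotent_elem :: "'a::ring_1 \<Rightarrow> bool"
  where "idempotent_elem e \<longleftrightarrow> e * e = e"

definition unit_elem :: "'a::ring_1 \<Rightarrow> bool"
  where "unit_elem u \<longleftrightarrow> (\<exists>v. u * v = 1 \<and> v * u = 1)"

definition left_ideal :: "'a::ring_1 set \<Rightarrow> bool"
  where "left_ideal I \<longleftrightarrow>
    0 \<in> I \<and> (\<forall>x\<in>I. \<forall>y\<in>I. x + y \<in> I) \<and> (\<forall>r. \<forall>x\<in>I. r * x \<in> I)"

definition maximal_left_ideal :: "'a::ring_1 set \<Rightarrow> bool"
  where "maximal_left_ideal M \<longleftrightarrow>
    left_ideal M \<and> M \<noteq> UNIV \<and> (\<forall>I. left_ideal I \<and> M \<subseteq> I \<longrightarrow> I = M \<or> I = UNIV)"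

definition jacobson_radical :: "'a::ring_1 set"
  where "jacobson_radical = \<Inter> {M. maximal_left_ideal M}"

definition sqrt_jacobson_radical :: "'a::ring_1 set"
  where "sqrt_jacobson_radical = {z. \<exists>n\<ge>1. z ^ n \<in> jacobson_radical}"

definition uniquely_clean :: "'a::ring_1 itself \<Rightarrow> bool"
  where "uniquely_clean _ \<longleftrightarrow>
    (\<forall>a::'a. \<exists>!(e, u). idempotent_elem e \<and> unit_elem u \<and> a = e + u)"

definition uniquely_sqrt_J_clean :: "'a::ring_1 itself \<Rightarrow> bool"
  where "uniquely_sqrt_J_clean _ \<longleftrightarrow>
    (\<forall>a::'a. \<exists>!(e, z). idempotent_elem e \<and> z \<in> sqrt_jacobson_radical \<and> a = e + z)"

end

theory Submission
  imports Defs
begin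

text \<open>
  In a ring of either kind the units turn out to be exactly the elements \<open>1 + z\<close> with
  \<open>z \<in> \<surd>J\<close>, and this is what makes the two decompositions interchangeable. In every ring
  \<open>1 + z\<close> is a unit, since \<open>1 - z\<close> divides \<open>1 - z ^ n\<close> on both sides. The work lies in the
  converse, and both proofs of it rest on the centrality of idempotents: for an idempotent \<open>e\<close>,
  \<open>e + e * r * (1 - e)\<close> is an idempotent that differs from \<open>e\<close> by a square-zero element, and
  either uniqueness property identifies such a pair (\<open>idempotent_centralI\<close>).

  Let \<open>R\<close> be uniquely clean and \<open>u\<close> a unit. If \<open>1 - u\<close> were outside \<open>J\<close>, a clean
  decomposition of a suitable multiple of it would produce a nonzero idempotent
  \<open>e \<in> R (1 - u)\<close>. Both \<open>u\<close> and \<open>u - 1\<close> are then units in the corner \<open>e R\<close>, so \<open>u - e\<close> is a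
  unit of \<open>R\<close>, and \<open>u = 0 + u = e + (u - e)\<close> contradicts uniqueness. Hence
  \<open>u \<in> 1 + J\<close> (\<open>uniquely_clean_unit_minus_one\<close>), and the decompositions \<open>a = e + z\<close> are
  the clean decompositions \<open>a + 1 = e + (1 + z)\<close>.

  Let \<open>R\<close> be uniquely \<open>\<surd>J\<close>-clean and \<open>u = e + z\<close> a unit. In the corner of the central idempotent
  \<open>1 - e\<close> the unit \<open>u\<close> has a power in \<open>J\<close>, so \<open>1 - e \<in> J\<close> and \<open>e = 1\<close>
  (\<open>uniquely_sqrt_J_clean_unit_minus_one\<close>). For the unit \<open>-1\<close> this gives \<open>-2 \<in> \<surd>J\<close>, and even
  \<open>2 \<in> J\<close> because \<open>2\<close> is central. Clean decompositions \<open>a = f + u\<close> therefore match the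
  decompositions \<open>a = (1 - f) + (2 * f + (u - 1))\<close>, whose second summand lies in \<open>\<surd>J\<close>.
\<close>

section \<open>Unique pairs\<close>

lemma ex1_pairI:
  "P a b \<Longrightarrow> (\<And>x y. P x y \<Longrightarrow> x = a \<and> y = b) \<Longrightarrow> \<exists>!(x, y). P x y"
  by auto

lemma ex1_pair_unique: "\<exists>!(x, y). P x y \<Longrightarrow> P a b \<Longrightarrow> P c d \<Longrightarrow> a = c"
  by auto

lemma ex1_pair_ex: "\<exists>!(x, y). P x y \<Longrightarrow> \<exists>x y. P x y"
  by auto

section \<open>Units and the Jacobson radical\<close>

lemma unit_elem_mult:
  "unit_elem (u * v)" if uv: "unit_elem u" "unit_elem v" for u v :: "'a::ring_1"
proof -
  obtain u' v' where "u * u' = 1" "u' * u = 1" "v * v' = 1" "v' * v = 1"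
    using uv unfolding unit_elem_def by blast
  then have "(u * v) * (v' * u') = 1" "(v' * u') * (u * v) = 1"
    by (metis mult.assoc mult_1_left)+
  then show ?thesis unfolding unit_elem_def by blast
qed

lemma unit_elem_power: "unit_elem (u ^ n)" if "unit_elem u" for u :: "'a::ring_1"
  by (induction n) (use that in \<open>auto intro: unit_elem_mult simp: unit_elem_def[of 1]\<close>)

lemma left_ideal_jacobson_radical: "left_ideal (jacobson_radical :: 'a::ring_1 set)"
  unfolding left_ideal_def jacobson_radical_def maximal_left_ideal_def by auto

lemma
  shows zero_in_jacobson_radical: "0 \<in> (jacobson_radical :: 'a::ring_1 set)"
    and jacobson_radical_add:
      "\<And>x y :: 'a. x \<in> jacobson_radical \<Longrightarrow> y \<in> jacobson_radical \<Longrightarrow> x + y \<in> jacobson_radical"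
    and jacobson_radical_mult_left:
      "\<And>r x :: 'a. x \<in> jacobson_radical \<Longrightarrow> r * x \<in> jacobson_radical"
  using left_ideal_jacobson_radical[where 'a='a] unfolding left_ideal_def by blast+

lemma jacobson_radical_uminus:
  "- x \<in> jacobson_radical" if "x \<in> jacobson_radical" for x :: "'a::ring_1"
  using jacobson_radical_mult_left[OF that, of "-1"] by simp

lemma left_ideal_eq_UNIV_iff: "I = UNIV \<longleftrightarrow> 1 \<in> I" if "left_ideal I" for I :: "'a::ring_1 set"
  using that unfolding left_ideal_def by (metis UNIV_I UNIV_eq_I mult_1_right)

lemma left_ideal_Union_chain:
  fixes C :: "'a::ring_1 set set"
  assumes "C \<noteq> {}" and chain: "subset.chain A C" and ideals: "\<And>I. I \<in> C \<Longrightarrow> left_ideal I"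
  shows "left_ideal (\<Union>C)"
  unfolding left_ideal_def
proof (intro conjI ballI allI)
  show "0 \<in> \<Union>C" using assms unfolding left_ideal_def by blast
next
  fix x y assume "x \<in> \<Union>C" "y \<in> \<Union>C"
  then obtain I K where IK: "I \<in> C" "x \<in> I" "K \<in> C" "y \<in> K" by blast
  then have "I \<subseteq> K \<or> K \<subseteq> I" using chain unfolding subset.chain_def by blast
  then show "x + y \<in> \<Union>C" using IK ideals unfolding left_ideal_def by blast
next
  fix r x assume "x \<in> \<Union>C"
  then show "r * x \<in> \<Union>C" using ideals unfolding left_ideal_def by blast
qed

text \<open>
  Zorn's lemma, applied to the left ideals above \<open>I\<close> that avoid \<open>1\<close>: avoiding \<open>1\<close>, unlike
  being proper, visibly survives unions of chains.
\<close>

lemma left_ideal_le_maximal: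
  fixes I :: "'a::ring_1 set"
  assumes "left_ideal I" "1 \<notin> I"
  obtains M where "maximal_left_ideal M" "I \<subseteq> M"
proof -
  define A where "A = {K :: 'a set. left_ideal K \<and> I \<subseteq> K \<and> 1 \<notin> K}"
  have "I \<in> A" using assms by (simp add: A_def)
  have "\<exists>M\<in>A. \<forall>K\<in>A. M \<subseteq> K \<longrightarrow> K = M"
  proof (rule subset_Zorn_nonempty)
    show "A \<noteq> {}" using \<open>I \<in> A\<close> by blast
  next
    fix C assume C: "C \<noteq> {}" "subset.chain A C"
    then have "C \<subseteq> A" unfolding subset.chain_def by blast
    then have "left_ideal (\<Union>C)" "I \<subseteq> \<Union>C" "1 \<notin> \<Union>C"
      using left_ideal_Union_chain[OF C] C(1) unfolding A_def by blast+
    then show "\<Union>C \<in> A" by (simp add: A_def)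
  qed
  then obtain M where M: "M \<in> A" "\<And>K. K \<in> A \<Longrightarrow> M \<subseteq> K \<Longrightarrow> K = M" by blast
  have "K = M \<or> K = UNIV" if "left_ideal K" "M \<subseteq> K" for K
    using M that left_ideal_eq_UNIV_iff[OF that(1)] unfolding A_def by blast
  then have "maximal_left_ideal M"
    using M(1) left_ideal_eq_UNIV_iff unfolding maximal_left_ideal_def A_def by blast
  then show thesis using that M(1) unfolding A_def by blast
qed

lemma left_inverse_one_minus_jacobson_radical:
  fixes j :: "'a::ring_1"
  assumes "j \<in> jacobson_radical"
  shows "\<exists>w. w * (1 - j) = 1"
proof (rule ccontr)
  assume no: "\<not> ?thesis"
  define I where "I = range (\<lambda>w. w * (1 - j))"
  have "left_ideal I"
    unfolding left_ideal_def
  proof (intro conjI ballI allI)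
    show "0 \<in> I" unfolding I_def by (rule image_eqI[of _ _ 0]) auto
    show "x + y \<in> I" if "x \<in> I" "y \<in> I" for x y
      using that unfolding I_def by (metis (no_types, lifting) distrib_right rangeE rangeI)
    show "r * x \<in> I" if "x \<in> I" for r x
      using that unfolding I_def by (metis (no_types, lifting) mult.assoc rangeE rangeI)
  qed
  moreover have "1 \<notin> I" using no unfolding I_def by (metis (no_types, lifting) rangeE)
  ultimately obtain M where M: "maximal_left_ideal M" "I \<subseteq> M"
    by (rule left_ideal_le_maximal)
  have ideal: "left_ideal M" and "1 \<notin> M"
    using M(1) left_ideal_eq_UNIV_iff unfolding maximal_left_ideal_def by blast+
  have "1 - j \<in> M" using M(2) unfolding I_def by (metis mult_1_left rangeI subsetD)
  moreover have "j \<in> M" using assms M(1) unfolding jacobson_radical_def by blast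
  ultimately have "(1 - j) + j \<in> M" using ideal unfolding left_ideal_def by blast
  with \<open>1 \<notin> M\<close> show False by simp
qed

text \<open>
  The left inverse \<open>w\<close> of \<open>1 - j\<close> is itself \<open>1 - (- w * j)\<close>, so it has a left inverse as well,
  which can only be \<open>1 - j\<close>.
\<close>

lemma unit_one_minus_jacobson_radical:
  fixes j :: "'a::ring_1"
  assumes j: "j \<in> jacobson_radical"
  shows "unit_elem (1 - j)"
proof -
  obtain w where w: "w * (1 - j) = 1"
    using left_inverse_one_minus_jacobson_radical[OF j] by blast
  then have "w = 1 - (- w) * j" by (simp add: algebra_simps)
  moreover have "(- w) * j \<in> jacobson_radical" by (rule jacobson_radical_mult_left[OF j])
  ultimately obtain w' where "w' * w = 1"
    using left_inverse_one_minus_jacobson_radical by metis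
  then have "w' = 1 - j" using w by (metis mult.assoc mult_1_left mult_1_right)
  then show ?thesis using w \<open>w' * w = 1\<close> unfolding unit_elem_def by blast
qed

text \<open>
  If a maximal left ideal \<open>M\<close> misses \<open>x\<close>, then \<open>M + R x\<close> is the whole ring, so \<open>M\<close> contains
  some \<open>1 - r * x\<close>, which therefore cannot be a unit.
\<close>

lemma jacobson_radicalI:
  fixes x :: "'a::ring_1"
  assumes units: "\<And>r. unit_elem (1 - r * x)"
  shows "x \<in> jacobson_radical"
proof (rule ccontr)
  assume "x \<notin> jacobson_radical"
  then obtain M where M: "maximal_left_ideal M" "x \<notin> M"
    unfolding jacobson_radical_def by blast
  have ideal: "left_ideal M" and "1 \<notin> M"
    using M(1) left_ideal_eq_UNIV_iff unfolding maximal_left_ideal_def by blast+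
  have M0: "0 \<in> M" and Madd: "\<And>y z. y \<in> M \<Longrightarrow> z \<in> M \<Longrightarrow> y + z \<in> M"
    and Mmult: "\<And>r y. y \<in> M \<Longrightarrow> r * y \<in> M"
    using ideal unfolding left_ideal_def by blast+
  define K where "K = {m + r * x | m r. m \<in> M}"
  have "left_ideal K"
    unfolding left_ideal_def
  proof (intro conjI ballI allI)
    show "0 \<in> K" unfolding K_def using M0 by (auto intro!: exI[of _ 0])
  next
    fix y z assume "y \<in> K" "z \<in> K"
    then obtain m r n s where "y = m + r * x" "z = n + s * x" "m \<in> M" "n \<in> M"
      unfolding K_def by blast
    then have "y + z = (m + n) + (r + s) * x" "m + n \<in> M"
      using Madd by (simp_all add: algebra_simps)
    then show "y + z \<in> K" unfolding K_def by blast
  next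
    fix s y assume "y \<in> K"
    then obtain m r where "y = m + r * x" "m \<in> M" unfolding K_def by blast
    then have "s * y = s * m + (s * r) * x" "s * m \<in> M"
      using Mmult by (simp_all add: algebra_simps)
    then show "s * y \<in> K" unfolding K_def by blast
  qed
  moreover have "M \<subseteq> K"
  proof
    fix m assume "m \<in> M"
    moreover have "m = m + 0 * x" by simp
    ultimately show "m \<in> K" unfolding K_def by blast
  qed
  moreover have "x = 0 + 1 * x" by simp
  then have "x \<in> K" unfolding K_def using M0 by blast
  ultimately have "K = UNIV" using M unfolding maximal_left_ideal_def by blast
  then obtain m r where "1 = m + r * x" "m \<in> M" unfolding K_def by blast
  then have "1 - r * x \<in> M" by (metis add_diff_cancel_right')
  then show False
    using units[of r] Mmult \<open>1 \<notin> M\<close> unfolding unit_elem_def by metis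
qed

section \<open>Elements with a power in the Jacobson radical\<close>

lemma sqrt_jacobson_radicalI:
  "z ^ n \<in> jacobson_radical \<Longrightarrow> z \<in> sqrt_jacobson_radical" for z :: "'a::ring_1"
  using jacobson_radical_mult_left[of "z ^ n" z]
  unfolding sqrt_jacobson_radical_def
  by (auto intro!: exI[of _ "Suc n"])

lemma power_mult_distrib_commuting:
  fixes x y :: "'a::monoid_mult"
  assumes "x * y = y * x"
  shows "(x * y) ^ n = x ^ n * y ^ n"
proof (induction n)
  case (Suc n)
  have "(x * y) ^ Suc n = x * (y * x ^ n) * y ^ n" by (simp add: Suc mult.assoc)
  also have "y * x ^ n = x ^ n * y" using assms by (metis power_commuting_commutes)
  finally show ?case by (simp add: mult.assoc)
qed simp

lemma sqrt_jacobson_radical_mult_commuting: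
  fixes x z :: "'a::ring_1"
  assumes "z \<in> sqrt_jacobson_radical" "x * z = z * x"
  shows "x * z \<in> sqrt_jacobson_radical"
proof -
  obtain n where "z ^ n \<in> jacobson_radical"
    using assms(1) unfolding sqrt_jacobson_radical_def by blast
  then have "(x * z) ^ n \<in> jacobson_radical"
    using power_mult_distrib_commuting[OF assms(2)] jacobson_radical_mult_left by metis
  then show ?thesis by (rule sqrt_jacobson_radicalI)
qed

lemma sqrt_jacobson_radical_add_commuting:
  fixes j z :: "'a::ring_1"
  assumes z: "z \<in> sqrt_jacobson_radical" and j: "j \<in> jacobson_radical" and comm: "j * z = z * j"
  shows "z + j \<in> sqrt_jacobson_radical"
proof -
  have diff: "(z + j) ^ n - z ^ n \<in> jacobson_radical" for n
  proof (induction n)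
    case (Suc n)
    have "j * z ^ n = z ^ n * j" using comm by (metis power_commuting_commutes)
    then have "(z + j) ^ Suc n - z ^ Suc n = (z + j) * ((z + j) ^ n - z ^ n) + z ^ n * j"
      by (simp add: algebra_simps)
    then show ?case
      using Suc j by (simp add: jacobson_radical_add jacobson_radical_mult_left)
  qed (simp add: zero_in_jacobson_radical)
  obtain n where "z ^ n \<in> jacobson_radical"
    using z unfolding sqrt_jacobson_radical_def by blast
  with diff[of n] have "((z + j) ^ n - z ^ n) + z ^ n \<in> jacobson_radical"
    by (rule jacobson_radical_add)
  then show ?thesis by (intro sqrt_jacobson_radicalI[of _ n]) simp
qed

text \<open>
  The geometric sum turns an inverse of \<open>1 - z ^ n\<close> into a left and a right inverse of \<open>1 - z\<close>.
\<close>

lemma unit_one_minus_sqrt_jacobson_radical: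
  fixes z :: "'a::ring_1"
  assumes "z \<in> sqrt_jacobson_radical"
  shows "unit_elem (1 - z)"
proof -
  obtain n where "z ^ n \<in> jacobson_radical"
    using assms unfolding sqrt_jacobson_radical_def by blast
  then obtain v where v: "(1 - z ^ n) * v = 1" "v * (1 - z ^ n) = 1"
    using unit_one_minus_jacobson_radical unfolding unit_elem_def by blast
  define s where "s = (\<Sum>i<n. z ^ i)"
  have left: "(1 - z) * s = 1 - z ^ n"
    unfolding s_def by (induction n) (simp_all add: distrib_left, simp add: left_diff_distrib)
  have right: "s * (1 - z) = 1 - z ^ n"
    unfolding s_def
    by (induction n) (simp_all add: distrib_right, simp add: right_diff_distrib power_commutes)
  have "(1 - z) * (s * v) = 1" "(v * s) * (1 - z) = 1"
    using v left right by (metis mult.assoc)+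
  moreover from this have "v * s = s * v" by (metis mult.assoc mult_1_left mult_1_right)
  ultimately show ?thesis unfolding unit_elem_def by metis
qed

lemma unit_one_plus_sqrt_jacobson_radical:
  fixes z :: "'a::ring_1"
  assumes "z \<in> sqrt_jacobson_radical"
  shows "unit_elem (1 + z)"
  using unit_one_minus_sqrt_jacobson_radical[of "-1 * z"]
    sqrt_jacobson_radical_mult_commuting[OF assms, of "-1"] by simp

lemma square_zero_in_sqrt_jacobson_radical:
  "z * z = 0 \<Longrightarrow> z \<in> sqrt_jacobson_radical" for z :: "'a::ring_1"
  using sqrt_jacobson_radicalI[of z 2] zero_in_jacobson_radical by (simp add: power2_eq_square)

section \<open>Idempotents\<close>

lemma idempotent_one_minus: "idempotent_elem e \<Longrightarrow> idempotent_elem (1 - e)" for e :: "'a::ring_1"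
  unfolding idempotent_elem_def by (simp add: algebra_simps)

text \<open>
  The assumption holds in both kinds of rings. As \<open>e + e * r * (1 - e)\<close> and
  \<open>e + (1 - e) * r * e\<close> are idempotents that differ from \<open>e\<close> by square-zero elements, it forces
  \<open>e * r = e * r * e = r * e\<close>.
\<close>

lemma idempotent_centralI:
  fixes e r :: "'a::ring_1"
  assumes rigid: "\<And>e f :: 'a. idempotent_elem e \<Longrightarrow> idempotent_elem f \<Longrightarrow>
      (f - e) * (f - e) = 0 \<Longrightarrow> f = e"
    and e: "idempotent_elem e"
  shows "e * r = r * e"
proof -
  have ee: "e * e = e" and eex: "\<And>x. e * (e * x) = e * x"
    using e by (simp_all add: idempotent_elem_def flip: mult.assoc)
  have "e + (e * r - e * r * e) = e"
    by (rule rigid) (simp_all add: idempotent_elem_def algebra_simps ee eex)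
  moreover have "e + (r * e - e * r * e) = e"
    by (rule rigid) (simp_all add: idempotent_elem_def algebra_simps ee eex)
  ultimately show ?thesis by simp
qed

lemma idempotent_in_jacobson_radical:
  fixes e :: "'a::ring_1"
  assumes "idempotent_elem e" "e \<in> jacobson_radical"
  shows "e = 0"
proof -
  obtain v where "(1 - e) * v = 1"
    using unit_one_minus_jacobson_radical[OF assms(2)] unfolding unit_elem_def by blast
  moreover have "e * (1 - e) = 0"
    using assms(1) by (simp add: idempotent_elem_def algebra_simps)
  ultimately show ?thesis by (metis mult.assoc mult_1_right mult_zero_left)
qed

section \<open>Uniquely clean rings\<close>

lemma uniquely_clean_ex:
  fixes a :: "'a::ring_1"
  assumes "uniquely_clean TYPE('a)"
  obtains e u where "idempotent_elem e" "unit_elem u" "a = e + u"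
proof -
  have "\<exists>!(e, u). idempotent_elem e \<and> unit_elem u \<and> a = e + u"
    using assms unfolding uniquely_clean_def by (rule spec)
  from ex1_pair_ex[OF this] show thesis by (elim exE conjE) (erule (2) that)
qed

lemma uniquely_clean_unique:
  fixes e f u v :: "'a::ring_1"
  assumes "uniquely_clean TYPE('a)"
    and "idempotent_elem e" "unit_elem u" "idempotent_elem f" "unit_elem v" "e + u = f + v"
  shows "e = f"
proof -
  have ex1: "\<exists>!(g, w). idempotent_elem g \<and> unit_elem w \<and> e + u = g + w"
    using assms(1) unfolding uniquely_clean_def by blast
  show ?thesis
    by (rule ex1_pair_unique[OF ex1, where b = u and d = v]) (intro conjI refl assms)+
qed

lemma uniquely_clean_idempotent_central:
  fixes e r :: "'a::ring_1"
  assumes uc: "uniquely_clean TYPE('a)" and "idempotent_elem e"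
  shows "e * r = r * e"
proof (rule idempotent_centralI)
  fix e f :: 'a
  assume "idempotent_elem e" "idempotent_elem f" "(f - e) * (f - e) = 0"
  moreover from this have "unit_elem (1 + (f - e))"
    by (intro unit_one_plus_sqrt_jacobson_radical square_zero_in_sqrt_jacobson_radical)
  moreover have "unit_elem (1 :: 'a)" by (simp add: unit_elem_def)
  moreover have "f + 1 = e + (1 + (f - e))" by simp
  ultimately show "f = e" using uniquely_clean_unique[OF uc] by metis
qed fact

text \<open>
  This is the exchange property of clean rings. When \<open>x\<close> is outside the radical, some
  \<open>1 - r * x\<close> is not a unit. Decompose \<open>r * x = f + v\<close> cleanly. The idempotent \<open>e = 1 - f\<close>
  satisfies \<open>e * r * x = e * v\<close>, which makes \<open>e\<close> a multiple of \<open>x\<close>, and it is nonzero because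
  otherwise \<open>1 - r * x = - v\<close>. Multiplying the cofactor \<open>s\<close> by \<open>e\<close> places it in the corner
  \<open>e R\<close>, so that it is a left inverse of \<open>x\<close> there.
\<close>

lemma uniquely_clean_ex_idempotent:
  fixes x :: "'a::ring_1"
  assumes uc: "uniquely_clean TYPE('a)" and x: "x \<notin> jacobson_radical"
  obtains e s where "idempotent_elem e" "e \<noteq> 0" "s * x = e" "e * s = s"
proof -
  obtain r where r: "\<not> unit_elem (1 - r * x)" using x jacobson_radicalI by blast
  obtain f v where fv: "idempotent_elem f" "unit_elem v" "r * x = f + v"
    using uniquely_clean_ex[OF uc] by blast
  obtain w where w: "w * v = 1" "v * w = 1" using fv(2) unfolding unit_elem_def by blast
  define e where "e = 1 - f"
  have e: "idempotent_elem e" unfolding e_def by (rule idempotent_one_minus[OF fv(1)])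
  have central: "e * y = y * e" for y by (rule uniquely_clean_idempotent_central[OF uc e])
  have "e \<noteq> 0"
  proof
    assume "e = 0"
    then have "1 - r * x = - v" using fv(3) by (simp add: e_def)
    moreover have "unit_elem (- v)" using w unfolding unit_elem_def by (metis minus_mult_minus)
    ultimately show False using r by simp
  qed
  moreover have "(e * w * r) * x = e"
  proof -
    have "e * f = 0" using fv(1) by (simp add: e_def idempotent_elem_def algebra_simps)
    have "(e * w * r) * x = w * (e * (r * x))" by (simp add: central mult.assoc)
    also have "\<dots> = w * (e * v)" using \<open>e * f = 0\<close> by (simp add: fv(3) distrib_left)
    also have "\<dots> = e" using w by (metis central mult.assoc mult_1_left)
    finally show ?thesis .
  qed
  moreover have "e * (e * w * r) = e * w * r"
    using e by (simp add: idempotent_elem_def flip: mult.assoc)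
  ultimately show thesis using that e by blast
qed

text \<open>
  A nonzero idempotent \<open>e\<close> in \<open>R (1 - u)\<close> cuts out a corner \<open>e R\<close> in which \<open>u\<close> and \<open>u - 1\<close> are
  both units. Then \<open>u - e\<close> is a unit of \<open>R\<close>, with inverse \<open>(1 - e) * u\<inverse> - s\<close>, and
  \<open>u = 0 + u = e + (u - e)\<close> are two clean decompositions.
\<close>

lemma uniquely_clean_unit_minus_one:
  fixes u :: "'a::ring_1"
  assumes uc: "uniquely_clean TYPE('a)" and u: "unit_elem u"
  shows "1 - u \<in> jacobson_radical"
proof (rule ccontr)
  assume "1 - u \<notin> jacobson_radical"
  then obtain e s where e: "idempotent_elem e" "e \<noteq> 0" and s: "s * (1 - u) = e" "e * s = s"
    by (rule uniquely_clean_ex_idempotent[OF uc])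
  obtain u' where u': "u * u' = 1" "u' * u = 1" using u unfolding unit_elem_def by blast
  have central: "e * y = y * e" for y by (rule uniquely_clean_idempotent_central[OF uc e(1)])
  have ee: "e * e = e" using e(1) by (simp add: idempotent_elem_def)
  \<comment> \<open>The left inverse \<open>s\<close> of \<open>1 - u\<close> in the corner is a right inverse too, because
    \<open>g = (1 - u) * s\<close> is again a central idempotent.\<close>
  have right: "(1 - u) * s = e"
  proof -
    define g where "g = (1 - u) * s"
    have "g * g = (1 - u) * ((s * (1 - u)) * s)" by (simp only: g_def mult.assoc)
    then have "idempotent_elem g" by (simp add: idempotent_elem_def s g_def)
    then have "g * s = s * g" by (rule uniquely_clean_idempotent_central[OF uc])
    have "g = g * e" unfolding g_def using s(2) central by (metis mult.assoc)
    also have "\<dots> = s * g * (1 - u)" using s(1) \<open>g * s = s * g\<close> by (metis mult.assoc)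
    also have "\<dots> = (s * (1 - u)) * (s * (1 - u))" by (simp only: g_def mult.assoc)
    also have "\<dots> = e" by (simp add: s ee)
    finally show ?thesis unfolding g_def .
  qed
  define w where "w = (1 - e) * u' - s"
  have us: "u * s = s - e" and su: "s * u = s - e" and se: "s * e = s"
    using right s central by (simp_all add: algebra_simps)
  have euu: "e * (e * y) = e * y" "u * (e * y) = e * (u * y)" for y
    using ee central by (metis mult.assoc)+
  have "(u - e) * w = 1" "w * (u - e) = 1"
    unfolding w_def
    by (simp_all add: algebra_simps us su se s(2) ee euu u' central[of u', symmetric])
  then have "unit_elem (u - e)" unfolding unit_elem_def by blast
  then have "e = 0"
    using uniquely_clean_unique[OF uc e(1) _ _ u, of "u - e" 0] by (simp add: idempotent_elem_def)
  with e(2) show False by contradiction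
qed

text \<open>
  Shifting by \<open>1\<close> exchanges the two kinds of decomposition: \<open>a = e + z\<close> corresponds to
  \<open>a + 1 = e + (1 + z)\<close>, since the units of a uniquely clean ring are the \<open>1 + z\<close> with
  \<open>z \<in> \<surd>J\<close>.
\<close>

lemma uniquely_clean_imp_uniquely_sqrt_J_clean:
  assumes uc: "uniquely_clean TYPE('a::ring_1)"
  shows "uniquely_sqrt_J_clean TYPE('a)"
  unfolding uniquely_sqrt_J_clean_def
proof
  fix a :: 'a
  obtain e u where eu: "idempotent_elem e" "unit_elem u" "a + 1 = e + u"
    using uniquely_clean_ex[OF uc] by blast
  have "- (1 - u) \<in> jacobson_radical"
    by (intro jacobson_radical_uminus uniquely_clean_unit_minus_one[OF uc eu(2)])
  then have sqrt: "u - 1 \<in> sqrt_jacobson_radical"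
    using sqrt_jacobson_radicalI[of "u - 1" 1] by simp
  have a: "a = e + (u - 1)" using eu(3) by (simp add: algebra_simps)
  have unique: "f = e \<and> z = u - 1"
    if "idempotent_elem f" "z \<in> sqrt_jacobson_radical" "a = f + z" for f z
  proof -
    have "f + (1 + z) = e + u" using eu(3) that(3) by (simp add: algebra_simps)
    then have "f = e"
      using that eu unit_one_plus_sqrt_jacobson_radical uniquely_clean_unique[OF uc] by blast
    then show ?thesis using a that(3) by simp
  qed
  show "\<exists>!(e, z). idempotent_elem e \<and> z \<in> sqrt_jacobson_radical \<and> a = e + z"
  proof (rule ex1_pairI)
    show "idempotent_elem e \<and> u - 1 \<in> sqrt_jacobson_radical \<and> a = e + (u - 1)"
      by (intro conjI eu(1) sqrt a)
  qed (elim conjE, rule unique)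
qed

section \<open>Uniquely \<open>\<surd>J\<close>-clean rings\<close>

lemma uniquely_sqrt_J_clean_ex:
  fixes a :: "'a::ring_1"
  assumes "uniquely_sqrt_J_clean TYPE('a)"
  obtains e z where "idempotent_elem e" "z \<in> sqrt_jacobson_radical" "a = e + z"
proof -
  have "\<exists>!(e, z). idempotent_elem e \<and> z \<in> sqrt_jacobson_radical \<and> a = e + z"
    using assms unfolding uniquely_sqrt_J_clean_def by (rule spec)
  from ex1_pair_ex[OF this] show thesis by (elim exE conjE) (erule (2) that)
qed

lemma uniquely_sqrt_J_clean_unique:
  fixes e f y z :: "'a::ring_1"
  assumes "uniquely_sqrt_J_clean TYPE('a)"
    and "idempotent_elem e" "y \<in> sqrt_jacobson_radical"
    and "idempotent_elem f" "z \<in> sqrt_jacobson_radical" "e + y = f + z"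
  shows "e = f"
proof -
  have ex1: "\<exists>!(g, w). idempotent_elem g \<and> w \<in> sqrt_jacobson_radical \<and> e + y = g + w"
    using assms(1) unfolding uniquely_sqrt_J_clean_def by blast
  show ?thesis
    by (rule ex1_pair_unique[OF ex1, where b = y and d = z]) (intro conjI refl assms)+
qed

lemma uniquely_sqrt_J_clean_idempotent_central:
  fixes e r :: "'a::ring_1"
  assumes uj: "uniquely_sqrt_J_clean TYPE('a)" and "idempotent_elem e"
  shows "e * r = r * e"
proof (rule idempotent_centralI)
  fix e f :: 'a
  assume ef: "idempotent_elem e" "idempotent_elem f" and "(f - e) * (f - e) = 0"
  then have "f - e \<in> sqrt_jacobson_radical"
    by (intro square_zero_in_sqrt_jacobson_radical)
  moreover have "0 \<in> (sqrt_jacobson_radical :: 'a set)"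
    by (simp add: square_zero_in_sqrt_jacobson_radical)
  moreover have "f + 0 = e + (f - e)" by simp
  ultimately show "f = e" using uniquely_sqrt_J_clean_unique[OF uj] ef by metis
qed fact

text \<open>
  Write \<open>u = e + z\<close>. In the corner cut out by the central idempotent \<open>1 - e\<close> the unit \<open>u\<close>
  equals \<open>z\<close>, so a power of a unit of that corner lies in the radical; hence \<open>1 - e\<close> does,
  and it vanishes.
\<close>

lemma uniquely_sqrt_J_clean_unit_minus_one:
  fixes u :: "'a::ring_1"
  assumes uj: "uniquely_sqrt_J_clean TYPE('a)" and u: "unit_elem u"
  shows "u - 1 \<in> sqrt_jacobson_radical"
proof -
  obtain e z where ez: "idempotent_elem e" "z \<in> sqrt_jacobson_radical" "u = e + z"
    using uniquely_sqrt_J_clean_ex[OF uj] by blast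
  define f where "f = 1 - e"
  have f: "idempotent_elem f" unfolding f_def by (rule idempotent_one_minus[OF ez(1)])
  have central: "f * y = y * f" for y
    by (rule uniquely_sqrt_J_clean_idempotent_central[OF uj f])
  have "f * e = 0" using ez(1) by (simp add: f_def idempotent_elem_def algebra_simps)
  then have "f * u = f * z" using ez(3) by (simp add: distrib_left)
  then have powers: "f ^ n * u ^ n = f ^ n * z ^ n" for n
    by (metis central power_mult_distrib_commuting)
  obtain n where n: "n \<ge> 1" "z ^ n \<in> jacobson_radical"
    using ez(2) unfolding sqrt_jacobson_radical_def by blast
  have "f ^ Suc k = f" for k
    using f by (induction k) (simp_all add: idempotent_elem_def)
  then have "f ^ n = f" using n(1) by (metis Suc_diff_le diff_Suc_1 One_nat_def Suc_le_D)
  then have "f * u ^ n \<in> jacobson_radical"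
    using powers[of n] jacobson_radical_mult_left[OF n(2), of f] by simp
  moreover obtain w where "w * u ^ n = 1"
    using unit_elem_power[OF u] unfolding unit_elem_def by blast
  then have "w * (f * u ^ n) = f" by (metis central mult.assoc mult_1_right)
  ultimately have "f \<in> jacobson_radical" using jacobson_radical_mult_left by metis
  then have "f = 0" by (rule idempotent_in_jacobson_radical[OF f])
  then show ?thesis using ez by (simp add: f_def)
qed

text \<open>
  As \<open>-1\<close> is a unit, some power of \<open>-2\<close> lies in the radical. Since \<open>-2\<close> is central, the same
  holds for each of its multiples, which puts \<open>2\<close> itself into the radical.
\<close>

lemma uniquely_sqrt_J_clean_two:
  assumes uj: "uniquely_sqrt_J_clean TYPE('a::ring_1)"
  shows "(2 :: 'a) \<in> jacobson_radical"
proof (rule jacobson_radicalI)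
  fix r :: 'a
  have "unit_elem (-1 :: 'a)" unfolding unit_elem_def by (rule exI[of _ "-1"]) simp
  then have "-2 \<in> (sqrt_jacobson_radical :: 'a set)"
    using uniquely_sqrt_J_clean_unit_minus_one[OF uj] by fastforce
  moreover have "(- r) * (-2) = (-2) * (- r)" by (simp add: mult_2 mult_2_right)
  ultimately have "(- r) * (-2) \<in> sqrt_jacobson_radical"
    by (rule sqrt_jacobson_radical_mult_commuting)
  then show "unit_elem (1 - r * 2)"
    using unit_one_minus_sqrt_jacobson_radical by fastforce
qed

text \<open>
  Passing from \<open>e\<close> to \<open>1 - e\<close> exchanges the two kinds of decomposition:
  \<open>e + z = (1 - e) + (2 * e - 1 + z)\<close>, where \<open>2 * e - 1\<close> is a central square root of \<open>1\<close>, and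
  \<open>e + u = (1 - e) + (2 * e + (u - 1))\<close>, where \<open>2 * e\<close> lies in the radical.
\<close>

lemma uniquely_sqrt_J_clean_imp_uniquely_clean:
  assumes uj: "uniquely_sqrt_J_clean TYPE('a::ring_1)"
  shows "uniquely_clean TYPE('a)"
  unfolding uniquely_clean_def
proof
  fix a :: 'a
  obtain e z where ez: "idempotent_elem e" "z \<in> sqrt_jacobson_radical" "a = e + z"
    using uniquely_sqrt_J_clean_ex[OF uj] by blast
  define c where "c = 2 * e - 1"
  have "c * c = 1"
    using ez(1) by (simp add: c_def idempotent_elem_def algebra_simps mult_2 mult_2_right)
  have "c * z = z * c"
    using uniquely_sqrt_J_clean_idempotent_central[OF uj ez(1), of z]
    by (simp add: c_def algebra_simps mult_2 mult_2_right)
  then have "unit_elem (1 + c * z)"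
    using ez(2) by (intro unit_one_plus_sqrt_jacobson_radical sqrt_jacobson_radical_mult_commuting)
  moreover have "unit_elem c" using \<open>c * c = 1\<close> unfolding unit_elem_def by blast
  moreover have "c * (1 + c * z) = c + z"
    using \<open>c * c = 1\<close> by (simp add: distrib_left flip: mult.assoc)
  ultimately have unit: "unit_elem (c + z)" using unit_elem_mult by metis
  have a: "a = (1 - e) + (c + z)" using ez(3) by (simp add: c_def mult_2)
  have unique: "f = 1 - e \<and> u = c + z"
    if fu: "idempotent_elem f" "unit_elem u" "a = f + u" for f u
  proof -
    have "2 * f * (u - 1) = (u - 1) * (2 * f)"
      using uniquely_sqrt_J_clean_idempotent_central[OF uj fu(1), of u]
      by (simp add: algebra_simps mult_2 mult_2_right)
    moreover have "2 * f \<in> jacobson_radical"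
      using jacobson_radical_mult_left[OF uniquely_sqrt_J_clean_two[OF uj], of f]
      by (simp add: mult_2 mult_2_right)
    ultimately have "(u - 1) + 2 * f \<in> sqrt_jacobson_radical"
      using uniquely_sqrt_J_clean_unit_minus_one[OF uj fu(2)]
      by (intro sqrt_jacobson_radical_add_commuting)
    moreover have "e + z = (1 - f) + ((u - 1) + 2 * f)"
      using ez(3) fu(3) by (simp add: mult_2 algebra_simps)
    ultimately have "e = 1 - f"
      using uniquely_sqrt_J_clean_unique[OF uj ez(1,2) idempotent_one_minus[OF fu(1)]] by blast
    then show ?thesis using a fu(3) by simp
  qed
  show "\<exists>!(e, u). idempotent_elem e \<and> unit_elem u \<and> a = e + u"
  proof (rule ex1_pairI)
    show "idempotent_elem (1 - e) \<and> unit_elem (c + z) \<and> a = (1 - e) + (c + z)"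
      by (intro conjI idempotent_one_minus[OF ez(1)] unit a)
  qed (elim conjE, rule unique)
qed

theorem theorem4p5:
  "uniquely_clean TYPE('a::ring_1) \<longleftrightarrow> uniquely_sqrt_J_clean TYPE('a)"
  using uniquely_clean_imp_uniquely_sqrt_J_clean uniquely_sqrt_J_clean_imp_uniquely_clean
  by blast

end
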